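(* Let $n\geq 2$ and let $T\in \mathrm{so}(n,\mathbb{C})$. Then $$\sigma(\mathrm{ad}_T)=\{\lambda+\mu: \lambda,\mu\in\sigma(T)\}\setminus\{2z:z\in\Xi(T)\},$$ where $$\Xi(T)=\{z\in\sigma(T): \mathrm{rank}\,(T-z)^2=n-1 \text{ and there exist no distinct } z_1,z_2\in \sigma(T) \text{ with } 2z=z_1+z_2\}.$$
   Context: $\mathrm{so}(n,\mathbb{C})=\{X\in M_n(\mathbb{C}): X+X^{tr}=0\}$, where $M_n(\mathbb{C})$ is the set of $n\times n$ complex matrices and $X^{tr}$ is the transpose of $X$. It is a complex Lie algebra under $[X,Y]=XY-YX$. For $T\in\mathrm{so}(n,\mathbb{C})$, $\mathrm{ad}_T:\mathrm{so}(n,\mathbb{C})\to\mathrm{so}(n,\mathbb{C})$ is the linear map $\mathrm{ad}_T(X)=TX-XT$. $\sigma(\cdot)$ denotes the spectrum (set of eigenvalues): $\sigma(T)$ is that of the matrix $T$ acting on $\mathbb{C}^n$, and $\sigma(\mathrm{ad}_T)$ is that of the linear map $\mathrm{ad}_T$ on the vector space $\mathrm{so}(n,\mathbb{C})$. *)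

theory Defs
  imports
    Complex_Main
    "Jordan_Normal_Form.Spectral_Radius"
    "Jordan_Normal_Form.DL_Rank"
begin

definition so :: "nat \<Rightarrow> complex mat set" where
  "so n = {X \<in> carrier_mat n n. X + transpose_mat X = 0\<^sub>m n n}"

definition so_space :: "nat \<Rightarrow> (complex, complex mat) module" where
  "so_space n = (module_mat TYPE(complex) n n)\<lparr>carrier := so n\<rparr>"

definition ad :: "complex mat \<Rightarrow> complex mat \<Rightarrow> complex mat" where
  "ad T X = T * X - X * T"

text \<open>The scalars of \<open>V\<close> are all of \<open>'a\<close>, as in \<^const>\<open>class_ring\<close>. The operator \<open>f\<close> is
  meant to be a linear endomorphism of \<open>V\<close>; its values outside \<open>carrier V\<close> are irrelevant.\<close>

definition op_spectrum :: "('a :: field, 'v) module \<Rightarrow> ('v \<Rightarrow> 'v) \<Rightarrow> 'a set" where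
  "op_spectrum V f = {c. \<exists>v\<in>carrier V. v \<noteq> \<zero>\<^bsub>V\<^esub> \<and> f v = c \<odot>\<^bsub>V\<^esub> v}"

definition Xi :: "nat \<Rightarrow> complex mat \<Rightarrow> complex set" where
  "Xi n T = {z \<in> spectrum T.
     vec_space.rank n ((T - z \<cdot>\<^sub>m 1\<^sub>m n) ^\<^sub>m 2) = n - 1 \<and>
     \<not> (\<exists>z1\<in>spectrum T. \<exists>z2\<in>spectrum T. z1 \<noteq> z2 \<and> 2 * z = z1 + z2)}"

lemma op_spectrum_mat:
  assumes "T \<in> carrier_mat n n"
  shows "op_spectrum (module_vec TYPE(complex) n) (\<lambda>v. T *\<^sub>v v) = spectrum T"
  using assms by (auto simp: op_spectrum_def spectrum_def eigenvalue_def eigenvector_def module_vec_def)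

lemma so_submodule: "submodule class_ring (so n) (module_mat TYPE(complex) n n)"
proof -
  have idx: "X \<in> so n \<longleftrightarrow> X \<in> carrier_mat n n \<and> (\<forall>i<n. \<forall>j<n. X $$ (i,j) + X $$ (j,i) = 0)" for X
  proof (cases "X \<in> carrier_mat n n")
    case True
    then have "X + transpose_mat X = 0\<^sub>m n n \<longleftrightarrow>
        (\<forall>i<n. \<forall>j<n. (X + transpose_mat X) $$ (i,j) = 0\<^sub>m n n $$ (i,j))"
      by (subst mat_eq_iff) auto
    with True show ?thesis by (simp add: so_def)
  qed (simp add: so_def)
  have add: "X + Y \<in> so n" if "X \<in> so n" "Y \<in> so n" for X Y
    unfolding idx
  proof (intro conjI allI impI)
    show "X + Y \<in> carrier_mat n n" using that by (simp add: idx)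
    fix i j assume ij: "i < n" "j < n"
    have "(X + Y) $$ (i,j) + (X + Y) $$ (j,i) = (X $$ (i,j) + X $$ (j,i)) + (Y $$ (i,j) + Y $$ (j,i))"
      using that[THEN idx[THEN iffD1], THEN conjunct1] ij by simp
    also have "\<dots> = 0" using that ij by (simp add: idx)
    finally show "(X + Y) $$ (i,j) + (X + Y) $$ (j,i) = 0" .
  qed
  have smult: "c \<cdot>\<^sub>m X \<in> so n" if "X \<in> so n" for c X
    unfolding idx
  proof (intro conjI allI impI)
    show "c \<cdot>\<^sub>m X \<in> carrier_mat n n" using that by (simp add: idx)
    fix i j assume ij: "i < n" "j < n"
    have "(c \<cdot>\<^sub>m X) $$ (i,j) + (c \<cdot>\<^sub>m X) $$ (j,i) = c * (X $$ (i,j) + X $$ (j,i))"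
      using that[THEN idx[THEN iffD1], THEN conjunct1] ij by (simp add: distrib_left)
    also have "\<dots> = 0" using that ij by (simp add: idx)
    finally show "(c \<cdot>\<^sub>m X) $$ (i,j) + (c \<cdot>\<^sub>m X) $$ (j,i) = 0" .
  qed
  have "so n \<subseteq> carrier_mat n n" "0\<^sub>m n n \<in> so n"
    by (auto simp: idx)
  moreover have "module (class_ring :: complex ring) (module_mat TYPE(complex) n n)"
    using matrix_vs by (rule vectorspace.axioms)
  ultimately show ?thesis
    using add smult by (intro submodule.intro) (simp_all add: module_mat_simps)
qed

lemma so_space_vectorspace: "vectorspace class_ring (so_space n)"
  unfolding so_space_def
  by (intro vectorspace.subspace_is_vs[OF matrix_vs] subspace.intro matrix_vs so_submodule)

lemma so_transpose: "X \<in> so n \<longleftrightarrow> X \<in> carrier_mat n n \<and> transpose_mat X = - X"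
proof -
  have "X + transpose_mat X = 0\<^sub>m n n \<longleftrightarrow> transpose_mat X = - X" if X: "X \<in> carrier_mat n n"
  proof
    assume "X + transpose_mat X = 0\<^sub>m n n"
    then have "(X + transpose_mat X) $$ (j,i) = 0" if "i < n" "j < n" for i j
      using that by simp
    then show "transpose_mat X = - X"
      using X by (intro eq_matI) (auto simp: eq_neg_iff_add_eq_0 add.commute)
  next
    assume "transpose_mat X = - X"
    then show "X + transpose_mat X = 0\<^sub>m n n"
      using X by (intro eq_matI) auto
  qed
  then show ?thesis by (auto simp: so_def)
qed

lemma ad_in_so:
  assumes "T \<in> so n" "X \<in> so n"
  shows "ad T X \<in> so n"
proof -
  have T: "T \<in> carrier_mat n n" "transpose_mat T = - T"
    and X: "X \<in> carrier_mat n n" "transpose_mat X = - X"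
    using assms by (auto simp: so_transpose)
  have TX: "T * X \<in> carrier_mat n n" "X * T \<in> carrier_mat n n"
    using T(1) X(1) by auto
  have "transpose_mat (ad T X) = transpose_mat (T * X) - transpose_mat (X * T)"
    unfolding ad_def by (rule transpose_minus[OF TX])
  also have "\<dots> = X * T - T * X"
    using T X by (simp add: transpose_mult[of _ n n _ n])
  also have "\<dots> = - ad T X"
    unfolding ad_def using T(1) X(1)
    by (intro eq_matI) (auto simp del: index_mult_mat(1))
  finally show ?thesis
    using T(1) X(1) by (simp add: so_transpose ad_def minus_carrier_mat[OF TX(2)])
qed

lemma ad_linear:
  assumes "T \<in> so n"
  shows "linear_map class_ring (so_space n) (so_space n) (ad T)"
proof -
  interpret V: vectorspace "class_ring :: complex ring" "so_space n"
    by (rule so_space_vectorspace)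
  have T: "T \<in> carrier_mat n n" using assms by (simp add: so_def)
  show ?thesis
  proof (unfold_locales, unfold module_hom_def, intro CollectI conjI allI impI)
    show "ad T \<in> carrier (so_space n) \<rightarrow> carrier (so_space n)"
      using ad_in_so[OF assms] by (auto simp: so_space_def)
  next
    fix X Y assume "X \<in> carrier (so_space n) \<and> Y \<in> carrier (so_space n)"
    then have X: "X \<in> carrier_mat n n" and Y: "Y \<in> carrier_mat n n"
      by (auto simp: so_space_def so_def)
    have "ad T (X + Y) = (T * X + T * Y) - (X * T + Y * T)"
      using T X Y by (simp add: ad_def mult_add_distrib_mat[of _ n n _ n] add_mult_distrib_mat[of _ n n _ _ n])
    also have "\<dots> = ad T X + ad T Y"
      using T X Y by (intro eq_matI) (auto simp: ad_def)
    finally show "ad T (X \<oplus>\<^bsub>so_space n\<^esub> Y) = ad T X \<oplus>\<^bsub>so_space n\<^esub> ad T Y"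
      by (simp add: so_space_def module_mat_simps)
  next
    fix c :: complex and X
    assume "c \<in> carrier class_ring \<and> X \<in> carrier (so_space n)"
    then have X: "X \<in> carrier_mat n n" by (auto simp: so_space_def so_def)
    have "ad T (c \<cdot>\<^sub>m X) = c \<cdot>\<^sub>m (T * X) - c \<cdot>\<^sub>m (X * T)"
      using T X by (simp add: ad_def mult_smult_distrib[of _ n n _ n] mult_smult_assoc_mat[of _ n n _ n])
    also have "\<dots> = c \<cdot>\<^sub>m ad T X"
      using T X by (intro eq_matI) (auto simp: ad_def right_diff_distrib simp del: index_mult_mat(1))
    finally show "ad T (c \<odot>\<^bsub>so_space n\<^esub> X) = c \<odot>\<^bsub>so_space n\<^esub> ad T X"
      by (simp add: so_space_def module_mat_simps)
  qed
qed

end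

theory Submission
  imports Defs "Jordan_Normal_Form.Matrix_Kernel"
begin

text \<open>Since \<open>T\<^sup>T = - T\<close>, the map \<open>ad T\<close> is \<open>X \<mapsto> T X + X T\<^sup>T\<close> on antisymmetric matrices, that is, the
  action of \<open>T\<close> on bivectors. An eigenvector for \<open>\<lambda> + \<mu>\<close> is the wedge of two eigenvectors of \<open>T\<close>;
  for \<open>\<lambda> = \<mu> = z\<close> a second independent vector in the kernel of \<open>(T - z)\<^sup>2\<close> serves instead, and by
  rank-nullity there is one unless the rank is \<open>n - 1\<close>. Conversely, after a Schur triangularisation
  of \<open>T\<close> every eigenvalue of \<open>ad T\<close> is the sum of two diagonal entries at different positions. If
  both equal \<open>z\<close>, reordering the diagonal to start with \<open>z, z\<close> exhibits two independent vectors in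
  the kernel of \<open>(T - z)\<^sup>2\<close>.\<close>

section \<open>Rank and kernel dimension of a matrix\<close>

text \<open>Rank-nullity for multiplication by \<open>A\<close>: its image is the column space, its
  kernel is \<open>mat_kernel A\<close>.\<close>

lemma rank_add_kernel_dim:
  fixes A :: "'a :: field mat"
  assumes A: "A \<in> carrier_mat n m"
  shows "vec_space.rank n A + kernel_dim A = m"
proof -
  interpret N: vec_space "TYPE('a)" n .
  interpret K: kernel n m A by unfold_locales (rule A)
  let ?V = "module_vec TYPE('a) m" and ?W = "module_vec TYPE('a) n"
  interpret L: linear_map "class_ring :: 'a ring" ?V ?W "\<lambda>v. A *\<^sub>v v"
  proof (unfold_locales, unfold module_hom_def, intro CollectI conjI allI impI)
    show "(\<lambda>v. A *\<^sub>v v) \<in> carrier ?V \<rightarrow> carrier ?W"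
      using A by (auto simp: module_vec_simps)
  qed (use A in \<open>auto simp: module_vec_simps mult_add_distrib_mat_vec mult_mat_vec\<close>)
  have "L.imT = N.col_space A"
    using A by (auto simp: L.im_def N.col_space_eq[OF A] module_vec_simps)
  moreover have "L.kerT = mat_kernel A"
    by (auto simp: L.ker_def mat_kernel[OF A] module_vec_simps)
  ultimately show ?thesis
    using L.rank_nullity K.NC.fin_dim K.NC.dim_is_n
    by (simp add: N.rank_def N.col_space_def)
qed

text \<open>By rank-nullity the rank condition says that the kernel is a line, and a line is spanned
  by any of its nonzero vectors. This translates the rank condition in \<open>Xi\<close> into a
  statement about vectors.\<close>

lemma rank_eq_dim_pred_iff:
  fixes A :: "'a :: field mat"
  assumes A: "A \<in> carrier_mat n n" and a: "a \<in> mat_kernel A" "a \<noteq> 0\<^sub>v n"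
  shows "vec_space.rank n A = n - 1 \<longleftrightarrow> (\<forall>b\<in>mat_kernel A. \<exists>c. b = c \<cdot>\<^sub>v a)"
proof -
  interpret K: kernel n n A by unfold_locales (rule A)
  have ac: "a \<in> carrier_vec n" using a(1) A by (auto simp: mat_kernel)
  \<comment> \<open>Makes the truncated subtraction \<open>n - 1\<close> a genuine one.\<close>
  have n: "n > 0"
    using a(2) ac by (intro notI gr0I) auto
  have span: "K.span {a} = {c \<cdot>\<^sub>v a | c. True}"
  proof -
    have "K.NC.lincomb f {a} = f a \<cdot>\<^sub>v a" for f
      using ac by (simp add: K.NC.lincomb_def)
    then have "K.NC.span {a} = {c \<cdot>\<^sub>v a | c. True}"
      using K.NC.finite_span[of "{a}"] ac by (auto intro: exI[of _ "\<lambda>_. c" for c])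
    then show ?thesis using K.span_same[of "{a}"] a(1) by simp
  qed
  have li: "K.lin_indpt {a}"
    using K.Ker.lin_dep_iff_in_span[of "{}" a] K.Ker.span_empty K.Ker.finite_lin_indpt2[of "{}"] a by auto
  have "K.Ker.fin_dim"
    using kernel_basis_exists[OF A] by (auto simp: K.Ker.fin_dim_def K.Ker.basis_def)
  \<comment> \<open>The independent set \<open>{a}\<close> is a basis as soon as it generates, and
    in a one-dimensional space it always generates.\<close>
  then have "K.dim = 1 \<longleftrightarrow> K.gen_set {a}"
    using K.Ker.dim1I[of a] K.Ker.dim_li_is_basis[of "{a}"] li a by (auto simp: K.Ker.basis_def)
  also have "\<dots> \<longleftrightarrow> (\<forall>b\<in>mat_kernel A. \<exists>c. b = c \<cdot>\<^sub>v a)"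
    using mat_kernel_smult[OF A a(1)] by (auto simp: span)
  finally show ?thesis
    using rank_add_kernel_dim[OF A] n by auto
qed

section \<open>Entrywise and matrix-vector preliminaries\<close>

lemma so_index: "X \<in> so n \<longleftrightarrow> X \<in> carrier_mat n n \<and> (\<forall>i<n. \<forall>j<n. X $$ (i,j) = - X $$ (j,i))"
proof (cases "X \<in> carrier_mat n n")
  case True
  then have "X\<^sup>T = - X \<longleftrightarrow> (\<forall>i<n. \<forall>j<n. X $$ (j,i) = - X $$ (i,j))"
    by (subst mat_eq_iff) auto
  with True show ?thesis by (auto simp: so_transpose)
qed (simp add: so_def)

lemma op_spectrum_adI:
  assumes "X \<in> so n" "X \<noteq> 0\<^sub>m n n" "ad T X = c \<cdot>\<^sub>m X"
  shows "c \<in> op_spectrum (so_space n) (ad T)"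
  using assms by (auto simp: op_spectrum_def so_space_def module_mat_simps)

lemma mult_mat_zero_vec:
  fixes A :: "'a :: semiring_0 mat"
  assumes "A \<in> carrier_mat m n"
  shows "A *\<^sub>v 0\<^sub>v n = 0\<^sub>v m"
  using assms by (intro eq_vecI) auto

lemma mult_mat_unit_vec:
  fixes A :: "'a :: semiring_1 mat"
  assumes "A \<in> carrier_mat m n" "i < n"
  shows "A *\<^sub>v unit_vec n i = col A i"
  using assms by (intro eq_vecI) auto

lemma smult_zero_vec:
  fixes k :: "'a :: mult_zero"
  shows "k \<cdot>\<^sub>v 0\<^sub>v n = 0\<^sub>v n"
  by (intro eq_vecI) auto

lemma shifted_mult_vec:
  fixes T :: "'a :: comm_ring_1 mat"
  assumes "T \<in> carrier_mat n n" "v \<in> carrier_vec n"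
  shows "(T - z \<cdot>\<^sub>m 1\<^sub>m n) *\<^sub>v v = T *\<^sub>v v - z \<cdot>\<^sub>v v"
  using assms by (subst minus_mult_distrib_mat_vec[of _ n n]) auto

lemma mat_kernel_square:
  fixes N :: "'a :: comm_ring_1 mat"
  assumes "N \<in> carrier_mat n n"
  shows "mat_kernel (N ^\<^sub>m 2) = {v \<in> carrier_vec n. N *\<^sub>v (N *\<^sub>v v) = 0\<^sub>v n}"
  using assms by (auto simp: mat_kernel_def numeral_2_eq_2)

section \<open>Bivectors as antisymmetric matrices\<close>

text \<open>The matrix u v^T - v u^T, which represents the bivector of \<open>u\<close> and
  \<open>v\<close>.\<close>

definition wedge :: "'a :: comm_ring_1 vec \<Rightarrow> 'a vec \<Rightarrow> 'a mat" where
  "wedge u v = mat (dim_vec u) (dim_vec v) (\<lambda>(i,j). u $ i * v $ j - v $ i * u $ j)"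

lemma wedge_in_so:
  assumes "u \<in> carrier_vec n" "v \<in> carrier_vec n"
  shows "wedge u v \<in> so n"
  using assms by (auto simp: so_index wedge_def)

lemma wedge_nonzero:
  fixes u :: "'a :: field vec"
  assumes u: "u \<in> carrier_vec n" "u \<noteq> 0\<^sub>v n" and v: "v \<in> carrier_vec n" "\<And>k. v \<noteq> k \<cdot>\<^sub>v u"
  shows "wedge u v \<noteq> 0\<^sub>m n n"
proof
  assume *: "wedge u v = 0\<^sub>m n n"
  obtain k where k: "k < n" "u $ k \<noteq> 0"
    using u by (metis carrier_vecD eq_vecI index_zero_vec)
  \<comment> \<open>Column \<open>k\<close> of a vanishing wedge reads
    \<open>u $ i * v $ k = v $ i * u $ k\<close>; dividing by the nonzero \<open>u $ k\<close>
    yields the scalar.\<close>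
  have "v = (v $ k / u $ k) \<cdot>\<^sub>v u"
  proof (intro eq_vecI)
    fix i assume "i < dim_vec ((v $ k / u $ k) \<cdot>\<^sub>v u)"
    then have i: "i < n" using u by simp
    have "wedge u v $$ (i,k) = 0" using * i k by simp
    then show "v $ i = ((v $ k / u $ k) \<cdot>\<^sub>v u) $ i"
      using i k u v(1) by (simp add: wedge_def field_simps)
  qed (use u v in auto)
  then show False using v(2) by blast
qed

text \<open>Antisymmetry of \<open>T\<close> gives v^T T = - (T v)^T, so the commutator of
  \<open>T\<close> with u v^T is (T u) v^T + u (T v)^T: \<open>ad T\<close> acts on bivectors as a
  derivation.\<close>

lemma ad_wedge:
  assumes T: "T \<in> so n" and u: "u \<in> carrier_vec n" and v: "v \<in> carrier_vec n"
  shows "ad T (wedge u v) = wedge (T *\<^sub>v u) v + wedge u (T *\<^sub>v v)"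
proof (rule eq_matI)
  have anti: "T $$ (k,j) = - T $$ (j,k)" if "k < n" "j < n" for k j
    using T that unfolding so_index by blast
  have Tc: "T \<in> carrier_mat n n" using T by (simp add: so_def)
  have W: "wedge u v \<in> carrier_mat n n" using u v by (simp add: wedge_def)
  fix i j assume "i < dim_row (wedge (T *\<^sub>v u) v + wedge u (T *\<^sub>v v))"
    "j < dim_col (wedge (T *\<^sub>v u) v + wedge u (T *\<^sub>v v))"
  then have i: "i < n" and j: "j < n" using u v Tc by (auto simp: wedge_def)
  have act: "(T *\<^sub>v w) $ k = (\<Sum>l = 0..<n. T $$ (k,l) * w $ l)" if "k < n" "w \<in> carrier_vec n" for k w
    using Tc that by (auto simp: scalar_prod_def)
  have left: "(T * wedge u v) $$ (i,j) = (T *\<^sub>v u) $ i * v $ j - (T *\<^sub>v v) $ i * u $ j"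
  proof -
    have "(T * wedge u v) $$ (i,j) = (\<Sum>l = 0..<n. T $$ (i,l) * (u $ l * v $ j - v $ l * u $ j))"
      using Tc W i j u v by (auto simp: scalar_prod_def wedge_def intro!: sum.cong)
    also have "\<dots> = (T *\<^sub>v u) $ i * v $ j - (T *\<^sub>v v) $ i * u $ j"
      unfolding act[OF i u] act[OF i v] sum_distrib_right sum_subtractf[symmetric]
      by (intro sum.cong) (simp_all add: algebra_simps)
    finally show ?thesis .
  qed
  have right: "(wedge u v * T) $$ (i,j) = v $ i * (T *\<^sub>v u) $ j - u $ i * (T *\<^sub>v v) $ j"
  proof -
    have "(wedge u v * T) $$ (i,j) = (\<Sum>l = 0..<n. (u $ i * v $ l - v $ i * u $ l) * T $$ (l,j))"
      using Tc W i j u v by (auto simp: scalar_prod_def wedge_def intro!: sum.cong)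
    \<comment> \<open>Antisymmetry replaces column \<open>j\<close> of \<open>T\<close> by row
      \<open>j\<close>, so that the sums become entries of the images of \<open>u\<close> and
      \<open>v\<close>.\<close>
    also have "\<dots> = (\<Sum>l = 0..<n. (v $ i * u $ l - u $ i * v $ l) * T $$ (j,l))"
      by (intro sum.cong) (simp_all add: anti[OF _ j] algebra_simps)
    also have "\<dots> = v $ i * (T *\<^sub>v u) $ j - u $ i * (T *\<^sub>v v) $ j"
      unfolding act[OF j u] act[OF j v] sum_distrib_left sum_subtractf[symmetric]
      by (intro sum.cong) (simp_all add: algebra_simps)
    finally show ?thesis .
  qed
  have "ad T (wedge u v) $$ (i,j) = (T * wedge u v) $$ (i,j) - (wedge u v * T) $$ (i,j)"
    using Tc W i j by (simp add: ad_def del: index_mult_mat(1))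
  then show "ad T (wedge u v) $$ (i,j) = (wedge (T *\<^sub>v u) v + wedge u (T *\<^sub>v v)) $$ (i,j)"
    unfolding left right using Tc u v i j by (simp add: wedge_def algebra_simps del: index_mult_mat_vec)
qed (use T u v in \<open>auto simp: ad_def wedge_def so_def\<close>)

text \<open>The term with \<open>d\<close> drops out because the wedge of \<open>u\<close> with
  itself is zero. Taking \<open>d = 0\<close> covers two eigenvectors; \<open>l = m\<close> and
  \<open>d = 1\<close> cover a Jordan chain of length two.\<close>

lemma op_spectrum_ad_wedgeI:
  assumes T: "T \<in> so n" and u: "u \<in> carrier_vec n" "u \<noteq> 0\<^sub>v n"
    and v: "v \<in> carrier_vec n" "\<And>k. v \<noteq> k \<cdot>\<^sub>v u"
    and Tu: "T *\<^sub>v u = l \<cdot>\<^sub>v u" and Tv: "T *\<^sub>v v = m \<cdot>\<^sub>v v + d \<cdot>\<^sub>v u"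
  shows "l + m \<in> op_spectrum (so_space n) (ad T)"
proof (rule op_spectrum_adI)
  show "wedge u v \<in> so n" using u v by (intro wedge_in_so)
  show "wedge u v \<noteq> 0\<^sub>m n n" using wedge_nonzero u v .
  show "ad T (wedge u v) = (l + m) \<cdot>\<^sub>m wedge u v"
    unfolding ad_wedge[OF T u(1) v(1)] Tu Tv using u v
    by (intro eq_matI) (auto simp: wedge_def algebra_simps)
qed

section \<open>Sums of eigenvalues of \<open>T\<close> that are eigenvalues of
  \<open>ad T\<close>\<close>

lemma mem_spectrum_iff:
  assumes "T \<in> carrier_mat n n"
  shows "l \<in> spectrum T \<longleftrightarrow> (\<exists>u\<in>carrier_vec n. u \<noteq> 0\<^sub>v n \<and> T *\<^sub>v u = l \<cdot>\<^sub>v u)"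
  using assms by (auto simp: spectrum_def eigenvalue_def eigenvector_def)

lemma sum_distinct_in_op_spectrum_ad:
  assumes T: "T \<in> so n" and l: "l \<in> spectrum T" and m: "m \<in> spectrum T" and "l \<noteq> m"
  shows "l + m \<in> op_spectrum (so_space n) (ad T)"
proof -
  have Tc: "T \<in> carrier_mat n n" using T by (simp add: so_def)
  obtain u where u: "u \<in> carrier_vec n" "u \<noteq> 0\<^sub>v n" "T *\<^sub>v u = l \<cdot>\<^sub>v u"
    using l mem_spectrum_iff[OF Tc] by blast
  obtain v where v: "v \<in> carrier_vec n" "v \<noteq> 0\<^sub>v n" "T *\<^sub>v v = m \<cdot>\<^sub>v v"
    using m mem_spectrum_iff[OF Tc] by blast
  have indep: "v \<noteq> k \<cdot>\<^sub>v u" for k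
  proof
    assume *: "v = k \<cdot>\<^sub>v u"
    then have "T *\<^sub>v v = l \<cdot>\<^sub>v v" using Tc u by (simp add: mult_mat_vec smult_smult_assoc mult.commute)
    then have eq: "l \<cdot>\<^sub>v v = m \<cdot>\<^sub>v v" using v by simp
    have "v = 0\<^sub>v n"
    proof (intro eq_vecI)
      fix i assume "i < dim_vec (0\<^sub>v n)"
      then show "v $ i = 0\<^sub>v n $ i"
        using arg_cong[OF eq, of "\<lambda>w. w $ i"] v(1) \<open>l \<noteq> m\<close> by simp
    qed (use v in auto)
    with v show False by simp
  qed
  have "T *\<^sub>v v = m \<cdot>\<^sub>v v + 0 \<cdot>\<^sub>v u" using u v by (intro eq_vecI) auto
  then show ?thesis using op_spectrum_ad_wedgeI[OF T u(1,2) v(1) indep u(3)] by blast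
qed

lemma double_in_op_spectrum_ad:
  assumes T: "T \<in> so n" and z: "z \<in> spectrum T"
    and rank: "vec_space.rank n ((T - z \<cdot>\<^sub>m 1\<^sub>m n) ^\<^sub>m 2) \<noteq> n - 1"
  shows "2 * z \<in> op_spectrum (so_space n) (ad T)"
proof -
  have Tc: "T \<in> carrier_mat n n" using T by (simp add: so_def)
  define N where "N = T - z \<cdot>\<^sub>m 1\<^sub>m n"
  have N: "N \<in> carrier_mat n n" unfolding N_def by (rule minus_carrier_mat) simp
  have N_eq: "N *\<^sub>v v = T *\<^sub>v v - z \<cdot>\<^sub>v v" if "v \<in> carrier_vec n" for v
    unfolding N_def using Tc that by (rule shifted_mult_vec)
  have T_eq: "T *\<^sub>v v = z \<cdot>\<^sub>v v + 1 \<cdot>\<^sub>v (N *\<^sub>v v)" if "v \<in> carrier_vec n" for v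
    using that Tc by (subst N_eq) (auto intro!: eq_vecI simp del: index_mult_mat_vec)
  obtain u where u: "u \<in> carrier_vec n" "u \<noteq> 0\<^sub>v n" "T *\<^sub>v u = z \<cdot>\<^sub>v u"
    using z mem_spectrum_iff[OF Tc] by blast
  have Nu: "N *\<^sub>v u = 0\<^sub>v n" using u by (simp add: N_eq)
  then have "u \<in> mat_kernel (N ^\<^sub>m 2)" using N u by (simp add: mat_kernel_square mult_mat_zero_vec)
  then obtain v where v: "v \<in> carrier_vec n" "N *\<^sub>v (N *\<^sub>v v) = 0\<^sub>v n" "\<And>k. v \<noteq> k \<cdot>\<^sub>v u"
    using rank_eq_dim_pred_iff[of "N ^\<^sub>m 2" n u] rank N u(2) mat_kernel_square[OF N] by (auto simp flip: N_def)
  show ?thesis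
  \<comment> \<open>If \<open>N\<close> kills \<open>v\<close>, then \<open>u\<close> and
    \<open>v\<close> are independent eigenvectors for \<open>z\<close>. Otherwise the image of
    \<open>v\<close> under \<open>N\<close> is itself an eigenvector and forms a Jordan chain with
    \<open>v\<close>; it then takes the place of \<open>u\<close>.\<close>
  proof (cases "N *\<^sub>v v = 0\<^sub>v n")
    case True
    then have "T *\<^sub>v v = z \<cdot>\<^sub>v v + 0 \<cdot>\<^sub>v u"
      using T_eq[OF v(1)] u v by (auto intro!: eq_vecI)
    then show ?thesis
      unfolding mult_2 by (rule op_spectrum_ad_wedgeI[OF T u(1,2) v(1,3) u(3)])
  next
    case False
    define w where "w = N *\<^sub>v v"
    have w: "w \<in> carrier_vec n" "N *\<^sub>v w = 0\<^sub>v n" "w \<noteq> 0\<^sub>v n"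
      using N v False by (auto simp: w_def)
    have "T *\<^sub>v w = z \<cdot>\<^sub>v w"
      using T_eq[OF w(1)] w by (auto intro!: eq_vecI)
    moreover have "v \<noteq> k \<cdot>\<^sub>v w" for k
    proof
      assume "v = k \<cdot>\<^sub>v w"
      then have "N *\<^sub>v v = 0\<^sub>v n" using N w by (simp add: mult_mat_vec smult_zero_vec)
      with False show False ..
    qed
    ultimately show ?thesis
      unfolding mult_2 using T_eq[OF v(1), folded w_def]
      by (intro op_spectrum_ad_wedgeI[OF T w(1,3) v(1)])
  qed
qed

section \<open>Eigenvalues of \<open>ad T\<close> by triangularisation\<close>

text \<open>A nonzero entry \<open>Y\<^sub>i\<^sub>j\<close> with \<open>i + j\<close> maximal is multiplied by exactly \<open>U\<^sub>i\<^sub>i + U\<^sub>j\<^sub>j\<close>,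
  since the other terms in the sums for the products meet zeros of \<open>U\<close> or of \<open>Y\<close>.\<close>

lemma upper_triangular_so_eigenvalue:
  assumes U: "U \<in> carrier_mat n n" "upper_triangular U" and Y: "Y \<in> so n" "Y \<noteq> 0\<^sub>m n n"
    and eq: "U * Y + Y * U\<^sup>T = c \<cdot>\<^sub>m Y"
  shows "\<exists>i<n. \<exists>j<n. i \<noteq> j \<and> c = U $$ (i,i) + U $$ (j,j)"
proof -
  have Yc: "Y \<in> carrier_mat n n" using Y by (simp add: so_def)
  define S where "S = {(i,j). i < n \<and> j < n \<and> Y $$ (i,j) \<noteq> 0}"
  have "finite S" by (rule finite_subset[of _ "{..<n} \<times> {..<n}"]) (auto simp: S_def)
  moreover have "S \<noteq> {}"
    using Y(2) Yc by (auto simp: S_def mat_eq_iff)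
  ultimately have "\<exists>p\<in>S. \<forall>q\<in>S. fst q + snd q \<le> fst p + snd p"
    using Max_in[of "(\<lambda>p. fst p + snd p) ` S"] Max_ge[of "(\<lambda>p. fst p + snd p) ` S"] by fastforce
  then obtain i j where ij: "i < n" "j < n" "Y $$ (i,j) \<noteq> 0"
    and max: "\<And>k l. k < n \<Longrightarrow> l < n \<Longrightarrow> Y $$ (k,l) \<noteq> 0 \<Longrightarrow> k + l \<le> i + j"
    by (fastforce simp: S_def)
  have "(U * Y) $$ (i,j) = (\<Sum>k = 0..<n. U $$ (i,k) * Y $$ (k,j))"
    using U Yc ij by (auto simp: scalar_prod_def)
  also have "\<dots> = (\<Sum>k = 0..<n. if k = i then U $$ (i,i) * Y $$ (i,j) else 0)"
  proof (intro sum.cong refl)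
    fix k assume k: "k \<in> {0..<n}"
    \<comment> \<open>For \<open>k < i\<close> the entry of \<open>U\<close> lies below the
      diagonal; for \<open>k > i\<close> the entry of \<open>Y\<close> vanishes by maximality of
      \<open>i + j\<close>.\<close>
    show "U $$ (i,k) * Y $$ (k,j) = (if k = i then U $$ (i,i) * Y $$ (i,j) else 0)"
      using max[of k j] U ij k upper_triangularD[of U k i] by (cases k i rule: linorder_cases) auto
  qed
  finally have 1: "(U * Y) $$ (i,j) = U $$ (i,i) * Y $$ (i,j)" using ij by simp
  have "(Y * U\<^sup>T) $$ (i,j) = (\<Sum>k = 0..<n. Y $$ (i,k) * U $$ (j,k))"
    using U Yc ij by (auto simp: scalar_prod_def)
  also have "\<dots> = (\<Sum>k = 0..<n. if k = j then U $$ (j,j) * Y $$ (i,j) else 0)"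
  proof (intro sum.cong refl)
    fix k assume k: "k \<in> {0..<n}"
    show "Y $$ (i,k) * U $$ (j,k) = (if k = j then U $$ (j,j) * Y $$ (i,j) else 0)"
      using max[of i k] U ij k upper_triangularD[of U k j] by (cases k j rule: linorder_cases) auto
  qed
  finally have 2: "(Y * U\<^sup>T) $$ (i,j) = U $$ (j,j) * Y $$ (i,j)" using ij by simp
  have "(U * Y + Y * U\<^sup>T) $$ (i,j) = (U * Y) $$ (i,j) + (Y * U\<^sup>T) $$ (i,j)"
    using U Yc ij by (simp del: index_mult_mat(1))
  then have "(U $$ (i,i) + U $$ (j,j)) * Y $$ (i,j) = c * Y $$ (i,j)"
    unfolding eq 1 2 using Yc ij by (simp add: algebra_simps)
  then have "c = U $$ (i,i) + U $$ (j,j)" using ij by simp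
  \<comment> \<open>The chosen entry is nonzero, whereas the diagonal of \<open>Y\<close>
    vanishes.\<close>
  moreover have "i \<noteq> j"
  proof
    assume "i = j"
    then have "Y $$ (i,j) = - Y $$ (i,j)"
      using ij Y(1) unfolding so_index by blast
    then have "2 * Y $$ (i,j) = 0"
      unfolding mult_2 by (rule iffD1[OF eq_neg_iff_add_eq_0])
    with ij show False by simp
  qed
  ultimately show ?thesis using ij by blast
qed

text \<open>Schur triangularisation in which the order of the eigenvalues on the diagonal is
  prescribed by \<open>es\<close>; this freedom later brings a repeated eigenvalue to the
  front.\<close>

lemma schur_wit_exists:
  fixes A :: "complex mat"
  assumes A: "A \<in> carrier_mat n n" and es: "char_poly A = (\<Prod>e\<leftarrow>es. [:- e, 1:])"
  obtains B P Q where "B \<in> carrier_mat n n" "P \<in> carrier_mat n n" "Q \<in> carrier_mat n n"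
    "P * Q = 1\<^sub>m n" "Q * P = 1\<^sub>m n" "A = P * B * Q" "upper_triangular B" "diag_mat B = es"
proof -
  obtain B P Q where s: "schur_decomposition A es = (B,P,Q)" by (metis prod_cases3)
  then have wit: "similar_mat_wit A B P Q" and B: "upper_triangular B" "diag_mat B = es"
    using schur_decomposition[OF A es] by blast+
  show ?thesis
    using that[OF similar_mat_witD2(5,6,7,1,2,3)[OF A wit] B] .
qed

lemma spectrum_eq_set:
  fixes es :: "'a :: field list"
  assumes "A \<in> carrier_mat n n" "char_poly A = (\<Prod>e\<leftarrow>es. [:- e, 1:])"
  shows "spectrum A = set es"
  using assms by (auto simp: spectrum_def eigenvalue_root_char_poly poly_prod_list prod_list_zero_iff)

text \<open>With \<open>T = P * B * Q\<close> and \<open>Q\<close> inverse to \<open>P\<close>,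
  congruence by \<open>Q\<close> turns T X + X T^T into B Y + Y B^T, so the triangular case applies
  to \<open>B\<close>, whose diagonal is \<open>es\<close>.\<close>

lemma op_spectrum_ad_in_sums:
  assumes T: "T \<in> so n" and es: "char_poly T = (\<Prod>e\<leftarrow>es. [:- e, 1:])" and "length es = n"
    and c: "c \<in> op_spectrum (so_space n) (ad T)"
  shows "\<exists>i<n. \<exists>j<n. i \<noteq> j \<and> c = es ! i + es ! j"
proof -
  have Tc: "T \<in> carrier_mat n n" and Tt: "T\<^sup>T = - T" using T by (auto simp: so_transpose)
  obtain B P Q where [simp]: "B \<in> carrier_mat n n" "P \<in> carrier_mat n n" "Q \<in> carrier_mat n n"
    and PQ: "P * Q = 1\<^sub>m n" and QP: "Q * P = 1\<^sub>m n" and TB: "T = P * B * Q"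
    and B: "upper_triangular B" "diag_mat B = es"
    using schur_wit_exists[OF Tc es] .
  have PQt: "Q\<^sup>T * P\<^sup>T = 1\<^sub>m n" "P\<^sup>T * Q\<^sup>T = 1\<^sub>m n"
    by (simp_all add: PQ QP flip: transpose_mult[of _ n n _ n])
  obtain X where X: "X \<in> so n" "X \<noteq> 0\<^sub>m n n" "ad T X = c \<cdot>\<^sub>m X"
    using c by (auto simp: op_spectrum_def so_space_def module_mat_simps)
  have Xc [simp]: "X \<in> carrier_mat n n" and Xt: "X\<^sup>T = - X" using X by (auto simp: so_transpose)
  \<comment> \<open>Congruence is used because the conjugate \<open>Q * X * P\<close> need not be
    antisymmetric.\<close>
  define Y where "Y = Q * X * Q\<^sup>T"
  have Yc [simp]: "Y \<in> carrier_mat n n"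
    unfolding Y_def by (intro mult_carrier_mat[of _ n n]) simp_all
  have XY: "P * Y * P\<^sup>T = X"
  proof -
    have "P * Y * P\<^sup>T = (P * Q) * X * (Q\<^sup>T * P\<^sup>T)"
      by (simp add: Y_def assoc_mult_mat[of _ n n _ n _ n] mult_carrier_mat[of _ n n _ n])
    then show ?thesis by (simp add: PQ PQt left_mult_one_mat[of _ n n] right_mult_one_mat[of _ n n])
  qed
  have "Y\<^sup>T = Q * X\<^sup>T * Q\<^sup>T"
    by (simp add: Y_def transpose_mult[of _ n n _ n] assoc_mult_mat[of _ n n _ n _ n] mult_carrier_mat[of _ n n _ n])
  also have "\<dots> = - Y"
    using carrier_matD[OF Xc] carrier_matD[OF \<open>Q \<in> carrier_mat n n\<close>] by (simp add: Xt Y_def)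
  finally have "Y \<in> so n" by (simp add: so_transpose)
  moreover have "Y \<noteq> 0\<^sub>m n n"
  proof
    assume "Y = 0\<^sub>m n n"
    then have "X = 0\<^sub>m n n"
      by (simp add: left_mult_zero_mat[of _ n n] right_mult_zero_mat[of _ n n] flip: XY)
    with X show False by simp
  qed
  moreover have "B * Y + Y * B\<^sup>T = c \<cdot>\<^sub>m Y"
  proof -
    \<comment> \<open>Antisymmetry of \<open>T\<close> brings the eigenvalue equation into a form
      compatible with congruence.\<close>
    have "T * X + X * T\<^sup>T = c \<cdot>\<^sub>m X"
      using X(3) carrier_matD[OF Tc] carrier_matD[OF Xc] Tc
      by (simp add: Tt ad_def minus_add_uminus_mat[of _ n n] mult_carrier_mat[of _ n n _ n])
    then have "c \<cdot>\<^sub>m Y = Q * (T * X + X * T\<^sup>T) * Q\<^sup>T"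
      by (simp add: Y_def mult_smult_distrib[of _ n n _ n] mult_smult_assoc_mat[of _ n n _ n]
          mult_carrier_mat[of _ n n _ n])
    also have "\<dots> = Q * (T * X) * Q\<^sup>T + Q * (X * T\<^sup>T) * Q\<^sup>T"
      using Tc by (simp add: mult_add_distrib_mat[of _ n n _ n] add_mult_distrib_mat[of _ n n _ _ n]
          mult_carrier_mat[of _ n n _ n])
    also have "Q * (T * X) * Q\<^sup>T = (Q * P) * (B * Y)"
      by (simp add: TB Y_def assoc_mult_mat[of _ n n _ n _ n] mult_carrier_mat[of _ n n _ n])
    also have "\<dots> = B * Y" by (simp add: QP left_mult_one_mat[of _ n n] mult_carrier_mat[of _ n n _ n])
    also have "Q * (X * T\<^sup>T) * Q\<^sup>T = Y * B\<^sup>T * (P\<^sup>T * Q\<^sup>T)"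
      by (simp add: TB Y_def transpose_mult[of _ n n _ n] assoc_mult_mat[of _ n n _ n _ n]
          mult_carrier_mat[of _ n n _ n])
    also have "\<dots> = Y * B\<^sup>T" by (simp add: PQt right_mult_one_mat[of _ n n] mult_carrier_mat[of _ n n _ n])
    finally show ?thesis ..
  qed
  ultimately obtain i j where ij: "i < n" "j < n" "i \<noteq> j" "c = B $$ (i,i) + B $$ (j,j)"
    using upper_triangular_so_eigenvalue[of B n Y c] B by auto
  have "B $$ (k,k) = es ! k" if "k < n" for k
    using that B(2) \<open>B \<in> carrier_mat n n\<close> by (auto simp: diag_mat_def)
  with ij show ?thesis by auto
qed

section \<open>Repeated eigenvalues and the rank of the shifted square\<close>

text \<open>With \<open>z, z\<close> first on the diagonal, the first two Schur basis vectors span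
  an invariant plane on which T - z is strictly upper triangular, hence squares to zero. So the
  kernel of the square is not a line.\<close>

lemma rank_shifted_square_repeated_root:
  fixes T :: "complex mat"
  assumes T: "T \<in> carrier_mat n n" and es: "char_poly T = (\<Prod>e\<leftarrow>z # z # es. [:- e, 1:])"
  shows "vec_space.rank n ((T - z \<cdot>\<^sub>m 1\<^sub>m n) ^\<^sub>m 2) \<noteq> n - 1"
proof -
  obtain B P Q where B: "B \<in> carrier_mat n n" and P: "P \<in> carrier_mat n n" and Q: "Q \<in> carrier_mat n n"
    and PQ: "P * Q = 1\<^sub>m n" and QP: "Q * P = 1\<^sub>m n" and TB: "T = P * B * Q"
    and U: "upper_triangular B" and diag: "diag_mat B = z # z # es"
    using schur_wit_exists[OF T es] .
  have n: "n \<ge> 2" using arg_cong[OF diag, of length] B by (simp add: diag_mat_def)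
  have "diag_mat B ! 0 = z" "diag_mat B ! 1 = z" by (simp_all add: diag)
  then have d: "B $$ (0,0) = z" "B $$ (1,1) = z" using n B by (simp_all add: diag_mat_def)
  define N where "N = T - z \<cdot>\<^sub>m 1\<^sub>m n"
  have N: "N \<in> carrier_mat n n" unfolding N_def by (rule minus_carrier_mat) simp
  \<comment> \<open>For \<open>i < n\<close> these are the columns of \<open>P\<close>, the basis in
    which \<open>T\<close> has the matrix \<open>B\<close>.\<close>
  define e where "e i = P *\<^sub>v unit_vec n i" for i
  have e [simp]: "e i \<in> carrier_vec n" for i using P by (simp add: e_def)
  have [simp]: "dim_vec (e i) = n" for i using P by (simp add: e_def)
  have Qe: "Q *\<^sub>v e i = unit_vec n i" for i
  proof -
    have "Q *\<^sub>v e i = (Q * P) *\<^sub>v unit_vec n i"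
      using P Q by (simp add: e_def assoc_mult_mat_vec[of _ n n _ n])
    then show ?thesis by (simp add: QP)
  qed
  have Te: "T *\<^sub>v e i = P *\<^sub>v col B i" if "i < n" for i
  proof -
    have "T *\<^sub>v e i = P *\<^sub>v (B *\<^sub>v (Q *\<^sub>v e i))"
      using P Q B by (simp add: TB assoc_mult_mat_vec[of _ n n _ n])
    then show ?thesis using that B by (simp add: Qe mult_mat_unit_vec)
  qed
  have 0: "N *\<^sub>v e 0 = 0\<^sub>v n"
  proof -
    have "col B 0 = z \<cdot>\<^sub>v unit_vec n 0"
      using n B U d by (intro eq_vecI) (auto simp: upper_triangularD unit_vec_def)
    then have "T *\<^sub>v e 0 = z \<cdot>\<^sub>v e 0"
      using Te[of 0] n P by (simp add: e_def mult_mat_vec)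
    then show ?thesis
      unfolding N_def by (subst shifted_mult_vec[OF T]) auto
  qed
  have 1: "N *\<^sub>v e 1 = B $$ (0,1) \<cdot>\<^sub>v e 0"
  proof -
    have "col B 1 = z \<cdot>\<^sub>v unit_vec n 1 + B $$ (0,1) \<cdot>\<^sub>v unit_vec n 0"
    proof (intro eq_vecI)
      fix i assume "i < dim_vec (z \<cdot>\<^sub>v unit_vec n 1 + B $$ (0,1) \<cdot>\<^sub>v unit_vec n 0)"
      then have i: "i < n" by simp
      consider "i = 0" | "i = 1" | "1 < i" by linarith
      then show "col B 1 $ i = (z \<cdot>\<^sub>v unit_vec n 1 + B $$ (0,1) \<cdot>\<^sub>v unit_vec n 0) $ i"
        using i n B d upper_triangularD[OF U, of 1 i] by cases (auto simp: unit_vec_def)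
    qed (use B in auto)
    then have "T *\<^sub>v e 1 = z \<cdot>\<^sub>v e 1 + B $$ (0,1) \<cdot>\<^sub>v e 0"
      using Te[of 1] n P by (simp add: e_def mult_mat_vec mult_add_distrib_mat_vec[of _ n n])
    then show ?thesis
      unfolding N_def by (subst shifted_mult_vec[OF T]) (auto intro!: eq_vecI)
  qed
  have ker: "e 0 \<in> mat_kernel (N ^\<^sub>m 2)" "e 1 \<in> mat_kernel (N ^\<^sub>m 2)"
    using N by (simp_all add: mat_kernel_square 0 1[simplified] mult_mat_vec mult_mat_zero_vec smult_zero_vec)
  \<comment> \<open>Applying \<open>Q\<close> turns \<open>e 0\<close> and \<open>e 1\<close> back
    into unit vectors, whose independence is visible entrywise.\<close>
  have "e 0 \<noteq> 0\<^sub>v n"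
  proof
    assume "e 0 = 0\<^sub>v n"
    then have "unit_vec n 0 = (0\<^sub>v n :: complex vec)"
      using Qe[of 0] mult_mat_zero_vec[OF Q] by simp
    then show False using n by simp
  qed
  moreover have "e 1 \<noteq> k \<cdot>\<^sub>v e 0" for k
  proof
    assume "e 1 = k \<cdot>\<^sub>v e 0"
    then have "unit_vec n 1 = k \<cdot>\<^sub>v unit_vec n 0"
      using Qe[of 1] Qe[of 0] Q by (simp add: mult_mat_vec)
    then show False using n by (auto dest!: arg_cong[of _ _ "\<lambda>v. v $ 1"])
  qed
  ultimately show ?thesis
    using rank_eq_dim_pred_iff[of "N ^\<^sub>m 2" n "e 0"] N ker by (auto simp flip: N_def)
qed

text \<open>Allows the linear factors of the characteristic polynomial to be reordered.\<close>

lemma prod_list_cong_mset: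
  fixes f :: "'a \<Rightarrow> 'b :: comm_monoid_mult"
  assumes "mset xs = mset ys"
  shows "(\<Prod>x\<leftarrow>xs. f x) = (\<Prod>x\<leftarrow>ys. f x)"
  using assms by (metis mset_map prod_mset_prod_list)

text \<open>Two distinct positions force multiplicity at least two, so two copies of
  \<open>z\<close> can be split off and moved to the front.\<close>

lemma mset_repeated:
  assumes "i < length xs" "j < length xs" "i \<noteq> j" "xs ! i = z" "xs ! j = z"
  obtains ys where "mset xs = mset (z # z # ys)"
proof -
  have "{i,j} \<subseteq> {k. k < length xs \<and> xs ! k = z}" using assms by auto
  then have "card {i,j} \<le> count (mset xs) z"
    by (subst count_mset, subst count_list_eq_length_filter, subst length_filter_conv_card) 
       (auto intro!: card_mono simp: eq_commute)
  then have "{#z, z#} \<subseteq># mset xs" using assms(3) by (intro mset_subset_eqI) auto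
  then obtain M where "mset xs = {#z, z#} + M" by (auto simp: mset_subset_eq_exists_conv)
  then show ?thesis using that ex_mset[of M] by auto
qed

section \<open>The two inclusions of the spectrum formula\<close>

theorem theorem1p2:
  fixes n :: nat and T :: "complex mat"
  assumes "n \<ge> 2" and "T \<in> so n"
  shows "op_spectrum (so_space n) (ad T) =
    {l + m | l m. l \<in> spectrum T \<and> m \<in> spectrum T} - {2 * z | z. z \<in> Xi n T}"
proof -
  have T: "T \<in> carrier_mat n n" using assms by (simp add: so_def)
  obtain es where es: "char_poly T = (\<Prod>e\<leftarrow>es. [:- e, 1:])" "length es = n"
    using char_poly_factorized[OF T] by auto
  have spec: "spectrum T = set es" using spectrum_eq_set[OF T es(1)] .
  show ?thesis
  proof (intro Set.equalityI subsetI)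
    fix c assume c: "c \<in> op_spectrum (so_space n) (ad T)"
    obtain i j where ij: "i < n" "j < n" "i \<noteq> j" "c = es ! i + es ! j"
      using op_spectrum_ad_in_sums[OF assms(2) es c] by blast
    then have in_spec: "es ! i \<in> spectrum T" "es ! j \<in> spectrum T"
      using spec es(2) by auto
    \<comment> \<open>The second condition in \<open>Xi\<close> forces the two summands to coincide,
      so both equal \<open>z\<close>. Then \<open>z\<close> occurs at two positions of
      \<open>es\<close>, which contradicts the rank condition.\<close>
    have "c \<noteq> 2 * z" if z: "z \<in> Xi n T" for z
    proof
      assume cz: "c = 2 * z"
      have "\<not> (\<exists>z1\<in>spectrum T. \<exists>z2\<in>spectrum T. z1 \<noteq> z2 \<and> 2 * z = z1 + z2)"
        using z by (simp add: Xi_def)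
      moreover have sum: "2 * z = es ! i + es ! j" using cz ij(4) by (rule subst)
      ultimately have "es ! i = es ! j" using in_spec by blast
      with sum have eq: "es ! i = z" "es ! j = z" by auto
      obtain fs where "mset es = mset (z # z # fs)"
        using mset_repeated[OF _ _ ij(3) eq] ij(1,2) es(2) by blast
      then have "char_poly T = (\<Prod>e\<leftarrow>z # z # fs. [:- e, 1:])"
        unfolding es(1) by (rule prod_list_cong_mset)
      from rank_shifted_square_repeated_root[OF T this] z show False
        by (simp add: Xi_def)
    qed
    then show "c \<in> {l + m | l m. l \<in> spectrum T \<and> m \<in> spectrum T} - {2 * z | z. z \<in> Xi n T}"
      using in_spec ij(4) by blast
  next
    fix c assume "c \<in> {l + m | l m. l \<in> spectrum T \<and> m \<in> spectrum T} - {2 * z | z. z \<in> Xi n T}"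
    then obtain l m where c: "c = l + m" "l \<in> spectrum T" "m \<in> spectrum T"
      and not_Xi: "\<And>z. z \<in> Xi n T \<Longrightarrow> c \<noteq> 2 * z" by blast
    show "c \<in> op_spectrum (so_space n) (ad T)"
    proof (cases "\<exists>z1\<in>spectrum T. \<exists>z2\<in>spectrum T. z1 \<noteq> z2 \<and> c = z1 + z2")
      case True
      then show ?thesis using sum_distinct_in_op_spectrum_ad[OF assms(2)] by blast
    next
      case False
      \<comment> \<open>Here \<open>l = m\<close>, and \<open>l\<close> meets the other conditions
        for \<open>Xi n T\<close>; since \<open>c\<close> is not among the removed values, the rank
        condition must fail.\<close>
      then have "c = 2 * l" using c by auto
      moreover from this False not_Xi[of l]
      have "vec_space.rank n ((T - l \<cdot>\<^sub>m 1\<^sub>m n) ^\<^sub>m 2) \<noteq> n - 1"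
        using c(2) by (auto simp: Xi_def)
      ultimately show ?thesis using double_in_op_spectrum_ad[OF assms(2) c(2)] by simp
    qed
  qed
qed

end
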